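(* Let $n\mid(q-1)$, let $b\ge1$, $m\ge1$, $\delta\ge2$ be integers with $\gcd(b,n)=1$ and $n\ge(2m+1)\delta$, and let $t\in\{0,\dots,n-1\}$. Put $B=\{1,\alpha^{b},\dots,\alpha^{(\delta-2)b}\}$ and $$A=\{\alpha^{t+jb}: 0\le j\le (m-1)\delta+1\}\cup\{\alpha^{t+((m+e)\delta+1)b}: e=0,1,\dots,m\}.$$ Let $d_A^{\perp}$ be the minimum distance of the dual of $C_A$. Then $C_{AB}$ is a cyclic $(d_A^{\perp}-\delta+1,\delta)$-LRC over $\mathbb{F}_q$ with dimension $k=n-m\delta-(m+1)(\delta-1)$. Moreover, if $\lceil k/r\rceil=m+1$ where $r=d_A^{\perp}-\delta+1$, then $C_{AB}$ is an optimal $(r,\delta)$-LRC with minimum distance $(m+1)\delta$.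
   Context: Let $q$ be a prime power and $n\mid(q-1)$, so the set $R_n$ of all $n$-th roots of unity lies in $\mathbb{F}_q$; let $\alpha\in\mathbb{F}_q$ be a primitive $n$-th root of unity. For $A,B\subseteq R_n$, $AB=\{\beta\gamma:\beta\in A,\gamma\in B\}$, and for $Z\subseteq R_n$, $C_Z$ denotes the cyclic code of length $n$ over $\mathbb{F}_q$ with complete defining set $Z$, i.e. the ideal generated by $\prod_{\beta\in Z}(x-\beta)$ in $\mathbb{F}_q[x]/(x^n-1)$, identified with a subspace of $\mathbb{F}_q^n$; it has dimension $n-|Z|$. Locality: for a linear code $C\subseteq\mathbb{F}_q^n$ and integers $r\ge1$, $\delta\ge2$, the $i$-th coordinate has $(r,\delta)$-locality if there is $S_i\subseteq\{1,\dots,n\}$ with $i\in S_i$, $|S_i|\le r+\delta-1$ such that the punctured code $C|_{S_i}$ has minimum distance at least $\delta$; $C$ is an $(r,\delta)$-LRC if every coordinate has $(r,\delta)$-locality. An $[n,k,d]$ $(r,\delta)$-LRC is optimal if $d=n-k-(\lceil k/r\rceil-1)(\delta-1)+1$ (this quantity is always an upper bound on $d$). *)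

theory Defs
  imports Complex_Main "HOL-Computational_Algebra.Polynomial" "HOL-Library.Function_Algebras"
    "HOL-Library.Extended_Nat"
begin

text \<open>Vectors of length n over a field are functions nat => 'a vanishing outside {0..<n};
  coordinate i (0 <= i < n) corresponds to the coefficient of x^i.\<close>

definition vecs :: "nat \<Rightarrow> (nat \<Rightarrow> 'a::zero) set" where
  "vecs n = {c. \<forall>i\<ge>n. c i = 0}"

definition vec_poly :: "nat \<Rightarrow> (nat \<Rightarrow> 'a::comm_ring_1) \<Rightarrow> 'a poly" where
  "vec_poly n c = (\<Sum>i<n. monom (c i) i)"

definition gen_poly :: "'a::comm_ring_1 set \<Rightarrow> 'a poly" where
  "gen_poly Z = (\<Prod>\<beta>\<in>Z. [:-\<beta>, 1:])"

text \<open>Cyclic code of length n with complete defining set Z: the ideal generated by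
  prod_{beta in Z} (x - beta) in F[x]/(x^n - 1), identified with F^n.\<close>
definition cyclic_code :: "nat \<Rightarrow> 'a::field set \<Rightarrow> (nat \<Rightarrow> 'a) set" where
  "cyclic_code n Z = {c \<in> vecs n. \<exists>f. vec_poly n c = (f * gen_poly Z) mod (monom 1 n - 1)}"

definition dual_code :: "nat \<Rightarrow> (nat \<Rightarrow> 'a::field) set \<Rightarrow> (nat \<Rightarrow> 'a) set" where
  "dual_code n C = {v \<in> vecs n. \<forall>c\<in>C. (\<Sum>i<n. c i * v i) = 0}"

definition code_dim :: "(nat \<Rightarrow> 'a::field) set \<Rightarrow> nat" where
  "code_dim C = vector_space.dim (\<lambda>a v i. a * v i) C"

definition hweight :: "nat \<Rightarrow> (nat \<Rightarrow> 'a::zero) \<Rightarrow> nat" where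
  "hweight n v = card {i. i < n \<and> v i \<noteq> 0}"

text \<open>Minimum distance (minimum weight of a nonzero codeword); infinity for the zero code.\<close>
definition min_dist :: "nat \<Rightarrow> (nat \<Rightarrow> 'a::zero) set \<Rightarrow> enat" where
  "min_dist n C = (INF v\<in>{v \<in> C. v \<noteq> 0}. enat (hweight n v))"

text \<open>Punctured code C|_S (coordinates outside S are deleted, here: set to 0).\<close>
definition puncture :: "nat set \<Rightarrow> (nat \<Rightarrow> 'a::zero) set \<Rightarrow> (nat \<Rightarrow> 'a) set" where
  "puncture S C = (\<lambda>c j. if j \<in> S then c j else 0) ` C"

definition has_locality :: "nat \<Rightarrow> (nat \<Rightarrow> 'a::zero) set \<Rightarrow> nat \<Rightarrow> nat \<Rightarrow> nat \<Rightarrow> bool" where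
  "has_locality n C r \<delta> i \<longleftrightarrow>
     (\<exists>S. S \<subseteq> {..<n} \<and> i \<in> S \<and> card S \<le> r + \<delta> - 1 \<and> min_dist n (puncture S C) \<ge> enat \<delta>)"

definition is_LRC :: "nat \<Rightarrow> (nat \<Rightarrow> 'a::zero) set \<Rightarrow> nat \<Rightarrow> nat \<Rightarrow> bool" where
  "is_LRC n C r \<delta> \<longleftrightarrow> r \<ge> 1 \<and> \<delta> \<ge> 2 \<and> (\<forall>i<n. has_locality n C r \<delta> i)"

definition is_optimal_LRC :: "nat \<Rightarrow> (nat \<Rightarrow> 'a::field) set \<Rightarrow> nat \<Rightarrow> nat \<Rightarrow> bool" where
  "is_optimal_LRC n C r \<delta> \<longleftrightarrow> is_LRC n C r \<delta> \<and>
     (\<exists>d. min_dist n C = enat d \<and>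
        int d = int n - int (code_dim C)
                - (\<lceil>real (code_dim C) / real r\<rceil> - 1) * (int \<delta> - 1) + 1)"

definition prim_root :: "nat \<Rightarrow> 'a::field \<Rightarrow> bool" where
  "prim_root n \<alpha> \<longleftrightarrow> \<alpha> ^ n = 1 \<and> (\<forall>k. 0 < k \<and> k < n \<longrightarrow> \<alpha> ^ k \<noteq> 1)"

definition set_mult :: "'a::times set \<Rightarrow> 'a set \<Rightarrow> 'a set" where
  "set_mult A B = {x * y | x y. x \<in> A \<and> y \<in> B}"

end

theory Submission
  imports Defs
begin

text \<open>
  Write \<open>\<gamma> = \<alpha>\<^sup>b\<close> and \<open>a = \<alpha>\<^sup>t\<close>. The set \<open>AB\<close> consists of the \<open>a \<gamma>\<^sup>j\<close> with \<open>0 \<le> j < (2m+1)\<delta>\<close>,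
  except the \<open>m + 1\<close> exponents \<open>j = m\<delta>, (m+1)\<delta>, \<dots>, 2m\<delta>\<close>; counting gives the dimension.

  Locality: if \<open>v\<close> lies in the dual of \<open>C\<^sub>A\<close> and \<open>c\<close> in \<open>C\<^sub>A\<^sub>B\<close>, then the componentwise product \<open>c v\<close>
  lies in \<open>C\<^sub>B\<close>, so by the BCH bound \<open>c\<close> is zero on the support of \<open>v\<close> or has at least \<open>\<delta>\<close> nonzero
  entries there. The cyclic shifts of a minimum weight \<open>v\<close> cover all coordinates, and this weight
  is at least \<open>\<delta>\<close> because the exponents of \<open>A\<close> have a gap of length \<open>\<delta> - 1\<close>.

  Distance from below: let \<open>c\<close> have weight \<open>w < (m+1)\<delta>\<close>, syndromes \<open>s\<^sub>j = c(a \<gamma>\<^sup>j)\<close> and locator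
  polynomial \<open>\<Lambda>\<close> of degree \<open>w\<close>. If \<open>s\<close> vanishes at \<open>m\<delta>\<close>, the BCH bound applies. Otherwise, the
  recurrences \<open>\<Sum>\<^sub>p \<Lambda>\<^sub>p s\<^bsub>i\<delta>+p\<^esub> = 0\<close> for \<open>i = 0, \<dots>, m\<close> only involve multiples \<open>p\<close> of \<open>\<delta>\<close> and form a triangular
  system, whence \<open>\<Lambda>\<^sub>0 = 0\<close>; but \<open>\<Lambda>\<^sub>0\<close> is up to sign the product of the nonzero locators.

  Distance from above: the Singleton bound for locally repairable codes, obtained by greedily
  adding local groups to an information set. Each group costs at most \<open>r\<close> coordinates and determines
  \<open>\<delta> - 1\<close> further ones.
\<close>

lemma sum_fun_apply: "(\<Sum>x\<in>X. f x) i = (\<Sum>x\<in>X. f x i)"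
  for f :: "'b \<Rightarrow> 'c \<Rightarrow> 'd::comm_monoid_add"
  by (induction X rule: infinite_finite_induct) auto

text \<open>The scaling is literally the one in \<open>code_dim\<close>, so that
  \<open>code_dim_def\<close> leads straight to \<open>fun_space.dim\<close> and its lemmas.\<close>

global_interpretation fun_space: vector_space "\<lambda>(a::'a::field) (v::nat \<Rightarrow> 'a) i. a * v i"
  by unfold_locales (auto simp: fun_eq_iff algebra_simps)

subsection \<open>Power moments and the bounds of BCH and Betti--Sala\<close>

lemma moment_poly:
  fixes c x :: "'i \<Rightarrow> 'a::comm_ring_1"
  shows "(\<Sum>i\<in>S. c i * poly f (x i)) = (\<Sum>p\<le>degree f. coeff f p * (\<Sum>i\<in>S. c i * x i ^ p))"
  by (simp add: poly_altdef sum_distrib_left mult_ac sum.swap[of _ S])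

lemma degree_prod_linear:
  fixes x :: "'i \<Rightarrow> 'a::idom"
  shows "degree (\<Prod>i\<in>S. [:- x i, 1:]) = card S"
  by (subst degree_prod_sum_eq) auto

text \<open>Invertibility of the Vandermonde matrix without determinants: a polynomial that vanishes
  at all nodes except \<open>x i\<close> isolates the term of \<open>c i\<close>. Its degree is
  below \<open>card S\<close>, so only the given moments occur.\<close>

lemma vanishing_moments_imp_zero:
  fixes c x :: "'i \<Rightarrow> 'a::idom"
  assumes fin: "finite S" and inj: "inj_on x S"
    and zero: "\<And>p. p < card S \<Longrightarrow> (\<Sum>i\<in>S. c i * x i ^ p) = 0"
    and i: "i \<in> S"
  shows "c i = 0"
proof -
  define f where "f = (\<Prod>j\<in>S - {i}. [:- x j, 1:])"
  have "degree f < card S"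
    using fin i by (simp only: f_def degree_prod_linear card_Diff1_less)
  then have "(\<Sum>j\<in>S. c j * poly f (x j)) = 0"
    by (subst moment_poly) (simp add: zero)
  moreover have "(\<Sum>j\<in>S. c j * poly f (x j)) = (\<Sum>j\<in>{i}. c j * poly f (x j))"
    using fin i by (intro sum.mono_neutral_right) (auto simp: f_def poly_prod)
  ultimately have "c i * poly f (x i) = 0" by simp
  moreover have "poly f (x i) \<noteq> 0"
    using fin i inj by (auto simp: f_def poly_prod inj_on_def)
  ultimately show ?thesis by simp
qed

text \<open>The distance bound freed from codes: \<open>S\<close> stands for the support of a
  codeword, the \<open>x i\<close> for its locators and the sums for its syndromes. The moments at
  \<open>m * \<delta>\<close>, \<open>(m + 1) * \<delta>\<close>, ...,
  \<open>2 * m * \<delta>\<close> are left open.\<close>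

theorem betti_sala_bound:
  fixes c x :: "'i \<Rightarrow> 'a::idom"
  assumes fin: "finite S" and ne: "S \<noteq> {}" and inj: "inj_on x S"
    and x: "\<And>i. i \<in> S \<Longrightarrow> x i \<noteq> 0" and c: "\<And>i. i \<in> S \<Longrightarrow> c i \<noteq> 0"
    and zero: "\<And>p. p < (2 * m + 1) * \<delta> \<Longrightarrow> \<not> (\<delta> dvd p \<and> m * \<delta> \<le> p) \<Longrightarrow> (\<Sum>i\<in>S. c i * x i ^ p) = 0"
  shows "(m + 1) * \<delta> \<le> card S"
proof (rule ccontr)
  assume "\<not> ?thesis"
  then have w: "card S < (m + 1) * \<delta>" by simp
  then have \<delta>: "\<delta> > 0" by (auto intro: gr0I)
  define M where "M p = (\<Sum>i\<in>S. c i * x i ^ p)" for p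
  define \<Lambda> where "\<Lambda> = (\<Prod>i\<in>S. [:- x i, 1:])"
  have deg: "degree \<Lambda> = card S" by (simp add: \<Lambda>_def degree_prod_linear)
  have only: "p = m * \<delta>" if "p < (m + 1) * \<delta>" "\<delta> dvd p" "m * \<delta> \<le> p" for p
  proof -
    obtain q where q: "p = \<delta> * q" using \<open>\<delta> dvd p\<close> by (elim dvdE)
    with that have "q * \<delta> < (m + 1) * \<delta>" "m * \<delta> \<le> q * \<delta>" by (simp_all add: mult.commute)
    with \<delta> have "q < m + 1" "m \<le> q" by (simp_all only: mult_less_cancel2 mult_le_cancel2)
    then show ?thesis using q by (simp add: mult.commute)
  qed
  \<comment> \<open>Below \<open>card S\<close>, at most the moment at \<open>m * \<delta>\<close>
    is not known to vanish. If it vanished too, the Vandermonde argument would make every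
    \<open>c i\<close> zero.\<close>
  have Mm: "M (m * \<delta>) \<noteq> 0"
  proof
    assume M0: "M (m * \<delta>) = 0"
    have "(\<Sum>i\<in>S. c i * x i ^ p) = 0" if "p < card S" for p
    proof (cases "\<delta> dvd p \<and> m * \<delta> \<le> p")
      case True
      with that w have "p = m * \<delta>" by (intro only) auto
      then show ?thesis using M0 by (simp add: M_def)
    next
      case False
      have "(m + 1) * \<delta> \<le> (2 * m + 1) * \<delta>" by (intro mult_right_mono) auto
      then show ?thesis using that w False by (intro zero) auto
    qed
    then have "c i = 0" if "i \<in> S" for i
      using vanishing_moments_imp_zero[OF fin inj _ that] by blast
    then show False using ne c by blast
  qed
  \<comment> \<open>Absorbing \<open>x i ^ s\<close> into the weights lets the locator polynomial,
    which is zero at every \<open>x i\<close>, annihilate the shifted syndromes.\<close>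
  have rec: "(\<Sum>p\<le>degree \<Lambda>. coeff \<Lambda> p * M (s + p)) = 0" for s
  proof -
    have "(\<Sum>p\<le>degree \<Lambda>. coeff \<Lambda> p * M (s + p)) = (\<Sum>i\<in>S. (c i * x i ^ s) * poly \<Lambda> (x i))"
      by (subst moment_poly) (simp add: M_def power_add mult_ac)
    also have "\<dots> = 0"
      using fin by (intro sum.neutral) (auto simp: \<Lambda>_def poly_prod)
    finally show ?thesis .
  qed
  \<comment> \<open>Take the recurrence with shift \<open>a * \<delta>\<close>. Terms with
    \<open>p = q * \<delta>\<close> and \<open>m - a < q\<close> drop out by induction, applied to
    \<open>m - q\<close>; all others except \<open>p = (m - a) * \<delta>\<close> drop out because
    their moment vanishes. The term left has the nonzero factor
    \<open>M (m * \<delta>)\<close>.\<close>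
  have "coeff \<Lambda> ((m - a) * \<delta>) = 0" if "a \<le> m" for a
    using that
  proof (induction a rule: less_induct)
    case (less a)
    have term0: "coeff \<Lambda> p * M (a * \<delta> + p) = 0" if p: "p \<le> degree \<Lambda>" "p \<noteq> (m - a) * \<delta>" for p
    proof (cases "\<delta> dvd p \<and> m * \<delta> \<le> a * \<delta> + p")
      case True
      then obtain q where q: "p = q * \<delta>" by (metis dvd_def mult.commute)
      have "q < m + 1" using p w deg q mult_less_cancel2[of q \<delta> "m + 1"] by simp
      moreover have "m * \<delta> \<le> (a + q) * \<delta>" using True q by (simp add: algebra_simps)
      then have "m \<le> a + q" using \<delta> by simp
      moreover have "q \<noteq> m - a" using p q by auto
      ultimately have "m - q < a" "m - (m - q) = q" "m - q \<le> m" by auto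
      then have "coeff \<Lambda> (q * \<delta>) = 0" using less.IH[of "m - q"] by simp
      then show ?thesis using q by simp
    next
      case False
      have "a * \<delta> \<le> m * \<delta>" using less.prems by simp
      \<comment> \<open>The factor \<open>2 * m + 1\<close> in the hypothesis on the moments comes
        from here: a shift of at most \<open>m * \<delta>\<close> plus an index below
        \<open>(m + 1) * \<delta>\<close>.\<close>
      moreover have "(2 * m + 1) * \<delta> = m * \<delta> + (m + 1) * \<delta>" by (simp add: algebra_simps)
      ultimately have "a * \<delta> + p < (2 * m + 1) * \<delta>" using p(1) w deg by linarith
      moreover have "\<delta> dvd a * \<delta> + p \<longleftrightarrow> \<delta> dvd p" by (simp add: dvd_add_right_iff)
      ultimately have "M (a * \<delta> + p) = 0"
        unfolding M_def using False by (intro zero) auto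
      then show ?thesis by simp
    qed
    show ?case
    proof (cases "(m - a) * \<delta> \<le> degree \<Lambda>")
      case True
      have "0 = (\<Sum>p\<in>{(m - a) * \<delta>}. coeff \<Lambda> p * M (a * \<delta> + p))"
        unfolding rec[of "a * \<delta>", symmetric]
        using True term0 by (intro sum.mono_neutral_right) auto
      moreover have "a * \<delta> + (m - a) * \<delta> = m * \<delta>"
        using less.prems by (simp flip: distrib_right)
      ultimately show ?thesis using Mm by simp
    qed (simp add: coeff_eq_0)
  qed
  from this[of m] have "poly \<Lambda> 0 = 0" by (simp add: poly_0_coeff_0)
  then show False using fin x by (simp add: \<Lambda>_def poly_prod)
qed

subsection \<open>Minimum distance and dimension\<close>

lemma le_min_dist_iff: "enat d \<le> min_dist n C \<longleftrightarrow> (\<forall>v\<in>C. v \<noteq> 0 \<longrightarrow> d \<le> hweight n v)"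
  by (auto simp: min_dist_def le_INF_iff)

lemma min_dist_le: "v \<in> C \<Longrightarrow> v \<noteq> 0 \<Longrightarrow> min_dist n C \<le> enat (hweight n v)"
  by (auto simp: min_dist_def intro: INF_lower)

lemma min_dist_attained:
  assumes "v \<in> C" "v \<noteq> 0"
  obtains w where "w \<in> C" "w \<noteq> 0" "min_dist n C = enat (hweight n w)"
proof -
  have "Inf ((\<lambda>v. enat (hweight n v)) ` {v \<in> C. v \<noteq> 0}) \<in> (\<lambda>v. enat (hweight n v)) ` {v \<in> C. v \<noteq> 0}"
    using assms by (intro wellorder_InfI) auto
  then show ?thesis using that by (auto simp: min_dist_def)
qed

text \<open>Restriction to \<open>I\<close> has rank at most \<open>card I\<close>, hence a
  nontrivial kernel on \<open>C\<close>: were it injective, it would map a basis of \<open>C\<close>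
  to independent vectors in the span of \<open>card I\<close> unit vectors.\<close>

lemma exists_codeword_vanishing_on:
  fixes C :: "(nat \<Rightarrow> 'a::field) set"
  assumes C: "fun_space.subspace C" and I: "finite I" "card I < code_dim C"
  obtains c where "c \<in> C" "c \<noteq> 0" "\<And>i. i \<in> I \<Longrightarrow> c i = 0"
proof -
  define R where "R v i = (if i \<in> I then v i else 0)" for v :: "nat \<Rightarrow> 'a" and i
  define e where "e j i = (if i = j then 1 else 0 :: 'a)" for i j :: nat
  interpret R: module_hom "\<lambda>(a::'a) v i. a * v i" "\<lambda>(a::'a) v i. a * v i" R
    by unfold_locales (auto simp: R_def fun_eq_iff)
  obtain X where X: "X \<subseteq> C" "fun_space.independent X" "C \<subseteq> fun_space.span X"
    "card X = fun_space.dim C" using fun_space.basis_exists[of C] by metis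
  have spanX: "fun_space.span X = C"
    using X C by (metis fun_space.span_minimal subset_antisym)
  have "\<not> inj_on R C"
  proof
    assume inj: "inj_on R C"
    have "R v \<in> fun_space.span (e ` I)" for v
    proof -
      have "R v = (\<Sum>j\<in>I. (\<lambda>i. v j * e j i))"
        using I(1) by (auto simp: fun_eq_iff sum_fun_apply R_def e_def if_distrib cong: if_cong)
      also have "\<dots> \<in> fun_space.span (e ` I)"
        by (intro fun_space.span_sum fun_space.span_scale fun_space.span_base) auto
      finally show ?thesis .
    qed
    moreover have "fun_space.independent (R ` X)"
      using X(2) inj by (intro R.independent_injective_image) (auto simp: spanX)
    ultimately have "card (R ` X) \<le> card (e ` I)"
      using fun_space.independent_span_bound[of "e ` I" "R ` X"] I(1) by auto
    also have "\<dots> \<le> card I" using I(1) by (rule card_image_le)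
    finally have "card X \<le> card I"
      using inj X(1) by (simp add: card_image inj_on_subset)
    then show False using I X(4) by (simp add: code_dim_def)
  qed
  then obtain c where "c \<in> C" "c \<noteq> 0" "R c = 0" using R.inj_on_iff_eq_0[OF C] by auto
  then show ?thesis using that[of c] by (auto simp: R_def fun_eq_iff split: if_splits)
qed

subsection \<open>The Singleton bound for locally repairable codes\<close>

text \<open>For a linear code this is the closure of \<open>I\<close> in the column matroid of a
  generator matrix: the coordinates whose values are fixed by those in \<open>I\<close>.\<close>

definition determined_coords :: "nat \<Rightarrow> (nat \<Rightarrow> 'a::zero) set \<Rightarrow> nat set \<Rightarrow> nat set" where
  "determined_coords n C I = {j. j < n \<and> (\<forall>c\<in>C. (\<forall>i\<in>I. c i = 0) \<longrightarrow> c j = 0)}"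

lemma finite_determined_coords [simp]: "finite (determined_coords n C I)"
  by (simp add: determined_coords_def)

lemma determined_coords_mono: "I \<subseteq> J \<Longrightarrow> determined_coords n C I \<subseteq> determined_coords n C J"
  by (auto simp: determined_coords_def)

lemma determined_coords_superset: "I \<subseteq> {..<n} \<Longrightarrow> I \<subseteq> determined_coords n C I"
  by (auto simp: determined_coords_def)

lemma exists_undetermined_coord:
  fixes C :: "(nat \<Rightarrow> 'a::field) set"
  assumes "fun_space.subspace C" "C \<subseteq> vecs n" "I \<subseteq> {..<n}" "card I < code_dim C"
  obtains c i where "c \<in> C" "\<And>j. j \<in> I \<Longrightarrow> c j = 0" "i < n" "c i \<noteq> 0"
proof -
  have "finite I" using assms(3) finite_subset by blast
  then obtain c where c: "c \<in> C" "c \<noteq> 0" "\<And>i. i \<in> I \<Longrightarrow> c i = 0"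
    using exists_codeword_vanishing_on assms by blast
  then obtain i where i: "c i \<noteq> 0" by (auto simp: fun_eq_iff)
  with c(1) assms(2) have "i < n" by (auto simp: vecs_def not_less[symmetric])
  with c i that show ?thesis by blast
qed

lemma hweight_puncture:
  "S \<subseteq> {..<n} \<Longrightarrow> hweight n (\<lambda>j. if j \<in> S then c j else 0) = card {j\<in>S. c j \<noteq> 0}"
  unfolding hweight_def by (rule arg_cong[of _ _ card]) auto

lemma has_locality_iff:
  "has_locality n C r \<delta> i \<longleftrightarrow>
     (\<exists>S\<subseteq>{..<n}. i \<in> S \<and> card S \<le> r + \<delta> - 1 \<and>
        (\<forall>c\<in>C. (\<exists>j\<in>S. c j \<noteq> 0) \<longrightarrow> \<delta> \<le> card {j\<in>S. c j \<noteq> 0}))"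
proof -
  have "enat \<delta> \<le> min_dist n (puncture S C) \<longleftrightarrow>
      (\<forall>c\<in>C. (\<exists>j\<in>S. c j \<noteq> 0) \<longrightarrow> \<delta> \<le> card {j\<in>S. c j \<noteq> 0})" if "S \<subseteq> {..<n}" for S
    using that by (auto simp: le_min_dist_iff puncture_def hweight_puncture fun_eq_iff)
  then show ?thesis unfolding has_locality_def by (intro iff_exI conj_cong refl)
qed

text \<open>Each further local group raises the surplus of determined over chosen coordinates by at
  least \<open>\<delta> - 1\<close>. As long as \<open>card I\<close> is below the dimension, some
  coordinate is undetermined and its group can be used next.\<close>

lemma LRC_small_information_set:
  fixes C :: "(nat \<Rightarrow> 'a::field) set"
  assumes sub: "fun_space.subspace C" and C: "C \<subseteq> vecs n" and lrc: "is_LRC n C r \<delta>"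
  shows "l * r < code_dim C \<Longrightarrow> \<exists>I\<subseteq>{..<n}. card I \<le> l * r \<and>
    card I + l * (\<delta> - 1) \<le> card (determined_coords n C I)"
proof (induction l)
  case 0
  then show ?case by (intro exI[of _ "{}"]) auto
next
  case (Suc l)
  let ?N = "determined_coords n C"
  from Suc obtain I where I: "I \<subseteq> {..<n}" "card I \<le> l * r"
    and cI: "card I + l * (\<delta> - 1) \<le> card (?N I)" by auto
  have finI: "finite I" using I(1) finite_subset by blast
  obtain c i where c: "c \<in> C" "\<And>j. j \<in> I \<Longrightarrow> c j = 0" "i < n" "c i \<noteq> 0"
  proof -
    have "card I < code_dim C" using I(2) Suc.prems by simp
    then show ?thesis using exists_undetermined_coord[OF sub C I(1)] that by blast
  qed
  have \<delta>: "\<delta> \<ge> 2" "has_locality n C r \<delta> i" using lrc \<open>i < n\<close> by (auto simp: is_LRC_def)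
  then obtain S where S: "S \<subseteq> {..<n}" "i \<in> S" "card S \<le> r + \<delta> - 1"
    and dist: "\<And>c. c \<in> C \<Longrightarrow> \<exists>j\<in>S. c j \<noteq> 0 \<Longrightarrow> \<delta> \<le> card {j\<in>S. c j \<noteq> 0}"
    unfolding has_locality_iff by auto
  have finS: "finite S" using S(1) finite_subset by blast
  define T where "T = S - ?N I"
  have finT: "finite T" using finS by (simp add: T_def)
  have zero_N: "c' j = 0" if "c' \<in> C" "\<And>i. i \<in> I \<Longrightarrow> c' i = 0" "j \<in> ?N I" for c' j
    using that by (auto simp: determined_coords_def)
  \<comment> \<open>The word \<open>c\<close> vanishes on everything determined by \<open>I\<close>,
    so its nonzero entries in \<open>S\<close> all lie in \<open>T\<close>.\<close>
  have "\<delta> \<le> card {j\<in>S. c j \<noteq> 0}" using dist c S by blast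
  also have "\<dots> \<le> card T"
    using finS zero_N[OF c(1,2)] by (intro card_mono) (auto simp: T_def)
  finally have \<delta>T: "\<delta> \<le> card T" .
  have cT: "card T \<le> r + \<delta> - 1"
    using S(3) card_mono[OF finS, of T] by (auto simp: T_def)
  \<comment> \<open>Leave out \<open>\<delta> - 1\<close> coordinates of \<open>T\<close>. A
    codeword that vanishes on \<open>I\<close> and \<open>T'\<close> has fewer than
    \<open>\<delta>\<close> nonzero entries in \<open>S\<close>, hence none, so the omitted
    coordinates are determined.\<close>
  obtain T' where T': "T' \<subseteq> T" "card T' = card T - (\<delta> - 1)" "finite T'"
    using obtain_subset_with_card_n[of "card T - (\<delta> - 1)" T] by auto
  have "T \<inter> ?N I = {}" by (auto simp: T_def)
  then have disj: "I \<inter> T' = {}" using determined_coords_superset[OF I(1), of C] T' by auto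
  have "T \<subseteq> ?N (I \<union> T')"
  proof
    fix j assume j: "j \<in> T"
    have "c' j = 0" if c': "c' \<in> C" "\<forall>i\<in>I \<union> T'. c' i = 0" for c'
    proof (rule ccontr)
      assume "c' j \<noteq> 0"
      then have "\<delta> \<le> card {j\<in>S. c' j \<noteq> 0}" using dist c' j by (auto simp: T_def)
      also have "\<dots> \<le> card (T - T')"
        using finT zero_N[OF c'(1)] c'(2) by (intro card_mono) (auto simp: T_def)
      also have "\<dots> = card T - card T'" using T' by (simp add: card_Diff_subset)
      also have "\<dots> < \<delta>" using T'(2) \<delta>T \<delta>(1) by simp
      finally show False by simp
    qed
    then show "j \<in> ?N (I \<union> T')" using j S(1) by (auto simp: determined_coords_def T_def)
  qed
  then have "card (?N I \<union> T) \<le> card (?N (I \<union> T'))"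
    using determined_coords_mono[of I "I \<union> T'" n C] by (intro card_mono) auto
  moreover have "card (?N I \<union> T) = card (?N I) + card T"
    using finT \<open>T \<inter> ?N I = {}\<close> by (intro card_Un_disjoint) auto
  moreover have IT: "card (I \<union> T') = card I + card T'"
    using finI T' disj by (intro card_Un_disjoint) auto
  moreover have "card T = card T' + (\<delta> - 1)" using T'(2) \<delta>T by simp
  ultimately have "card (I \<union> T') + Suc l * (\<delta> - 1) \<le> card (?N (I \<union> T'))"
    using cI by (simp only: mult_Suc)
  moreover have "card T' \<le> r" using T'(2) cT by simp
  then have "card (I \<union> T') \<le> Suc l * r" using IT I(2) by (simp only: mult_Suc)
  moreover have "I \<union> T' \<subseteq> {..<n}" using I(1) T' S(1) by (auto simp: T_def)
  ultimately show ?case by blast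
qed

text \<open>A nonzero codeword that vanishes on \<open>code_dim C - 1\<close> well-chosen
  coordinates vanishes on \<open>l * (\<delta> - 1)\<close> more. The largest admissible
  \<open>l\<close> is \<open>\<lceil>k / r\<rceil> - 1\<close> for \<open>k = code_dim C\<close>,
  which gives the value in the definition of optimality.\<close>

theorem LRC_singleton_bound:
  fixes C :: "(nat \<Rightarrow> 'a::field) set"
  assumes sub: "fun_space.subspace C" and C: "C \<subseteq> vecs n" and lrc: "is_LRC n C r \<delta>"
    and l: "l * r < code_dim C"
  shows "min_dist n C + enat (code_dim C - 1 + l * (\<delta> - 1)) \<le> enat n"
proof -
  let ?N = "determined_coords n C"
  obtain I0 where I0: "I0 \<subseteq> {..<n}" "card I0 \<le> l * r" "card I0 + l * (\<delta> - 1) \<le> card (?N I0)"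
    using LRC_small_information_set[OF sub C lrc l] by blast
  \<comment> \<open>Adding an undetermined coordinate enlarges \<open>I\<close> by one and the
    determined set by at least one, so the surplus survives up to size
    \<open>code_dim C - 1\<close>.\<close>
  have "\<exists>I\<subseteq>{..<n}. card I = j \<and> j + l * (\<delta> - 1) \<le> card (?N I)"
    if "card I0 \<le> j" "j \<le> code_dim C - 1" for j
    using that
  proof (induction j rule: dec_induct)
    case base
    then show ?case using I0 by blast
  next
    case (step j)
    then obtain I where I: "I \<subseteq> {..<n}" "card I = j" "j + l * (\<delta> - 1) \<le> card (?N I)" by auto
    have "card I < code_dim C" using I step by simp
    then obtain c i where c: "c \<in> C" "\<And>j. j \<in> I \<Longrightarrow> c j = 0" "i < n" "c i \<noteq> 0"
      using exists_undetermined_coord[OF sub C I(1)] by blast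
    have "insert i (?N I) \<subseteq> ?N (insert i I)"
      using determined_coords_mono[of I "insert i I" n C] c(3) by (auto simp: determined_coords_def)
    then have "card (insert i (?N I)) \<le> card (?N (insert i I))" by (intro card_mono) auto
    moreover have "i \<notin> ?N I" "i \<notin> I" using c by (auto simp: determined_coords_def)
    moreover have "finite I" using I(1) finite_subset by blast
    ultimately have "insert i I \<subseteq> {..<n} \<and> card (insert i I) = Suc j \<and>
        Suc j + l * (\<delta> - 1) \<le> card (?N (insert i I))"
      using I c(3) by simp
    then show ?case by blast
  qed
  from this[of "code_dim C - 1"] have "\<exists>I\<subseteq>{..<n}. card I = code_dim C - 1 \<and>
    code_dim C - 1 + l * (\<delta> - 1) \<le> card (?N I)" using I0(2) l by auto
  then obtain I where I: "I \<subseteq> {..<n}" "card I = code_dim C - 1"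
    "code_dim C - 1 + l * (\<delta> - 1) \<le> card (?N I)" by blast
  have "card I < code_dim C" using I(2) l by simp
  then obtain c i where c: "c \<in> C" "\<And>j. j \<in> I \<Longrightarrow> c j = 0" "i < n" "c i \<noteq> 0"
    using exists_undetermined_coord[OF sub C I(1)] by blast
  have "?N I \<subseteq> {..<n}" by (auto simp: determined_coords_def)
  then have "card ({..<n} - ?N I) = n - card (?N I)" "card (?N I) \<le> n"
    using card_mono[of "{..<n}" "?N I"] by (auto simp: card_Diff_subset)
  moreover have "hweight n c \<le> card ({..<n} - ?N I)"
    unfolding hweight_def using c by (intro card_mono) (auto simp: determined_coords_def)
  ultimately have weight: "hweight n c + (code_dim C - 1 + l * (\<delta> - 1)) \<le> n" using I(3) by linarith
  have "min_dist n C \<le> enat (hweight n c)" using c by (intro min_dist_le) (auto simp: fun_eq_iff)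
  then have "min_dist n C + enat (code_dim C - 1 + l * (\<delta> - 1)) \<le>
    enat (hweight n c) + enat (code_dim C - 1 + l * (\<delta> - 1))" by (rule add_right_mono)
  also have "\<dots> \<le> enat n" using weight by simp
  finally show ?thesis .
qed

subsection \<open>Cyclic codes\<close>

lemma coeff_vec_poly: "coeff (vec_poly n c) i = (if i < n then c i else 0)"
  by (simp add: vec_poly_def coeff_sum)

lemma poly_vec_poly: "poly (vec_poly n c) \<beta> = (\<Sum>i<n. c i * \<beta> ^ i)"
  by (simp add: vec_poly_def poly_sum poly_monom)

lemma coeff_vec_poly_vecs: "c \<in> vecs n \<Longrightarrow> coeff (vec_poly n c) = c"
  by (auto simp: coeff_vec_poly vecs_def fun_eq_iff)

lemma vec_poly_coeff: "coeff p \<in> vecs n \<Longrightarrow> vec_poly n (coeff p) = p"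
  by (auto simp: coeff_vec_poly vecs_def poly_eq_iff)

text \<open>Writes a multiple of \<open>g\<close> as a linear combination of shifts of
  \<open>g\<close>, which turns products of polynomials into statements about span and
  independence.\<close>

lemma coeff_vec_poly_mult:
  "coeff (vec_poly k u * g) i = (\<Sum>j<k. u j * coeff (monom 1 j * g) i)"
proof -
  have "monom (u j) j * g = smult (u j) (monom 1 j * g)" for j
    by (metis mult.right_neutral mult_smult_left smult_monom)
  then show ?thesis by (simp add: vec_poly_def sum_distrib_right coeff_sum)
qed

lemma gen_poly_dvd_iff:
  fixes Z :: "'a::field set"
  assumes "finite Z"
  shows "gen_poly Z dvd p \<longleftrightarrow> (\<forall>\<beta>\<in>Z. poly p \<beta> = 0)"
proof
  assume "gen_poly Z dvd p"
  then show "\<forall>\<beta>\<in>Z. poly p \<beta> = 0"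
    using assms by (auto simp: gen_poly_def poly_prod elim!: dvdE)
next
  show "\<forall>\<beta>\<in>Z. poly p \<beta> = 0 \<Longrightarrow> gen_poly Z dvd p"
    using assms
  proof (induction Z arbitrary: p rule: finite_induct)
    case (insert \<beta> Z)
    then obtain q where q: "p = [:-\<beta>, 1:] * q" by (auto simp: poly_eq_0_iff_dvd elim: dvdE)
    have "\<forall>\<beta>\<in>Z. poly q \<beta> = 0" using insert.prems insert.hyps by (auto simp: q)
    then have "gen_poly Z dvd q" by (rule insert.IH)
    then have "[:-\<beta>, 1:] * gen_poly Z dvd p" unfolding q by (rule mult_dvd_mono[OF dvd_refl])
    then show ?case using insert.hyps by (simp add: gen_poly_def)
  qed (simp add: gen_poly_def)
qed

lemma degree_gen_poly: "degree (gen_poly Z) = card Z" for Z :: "'a::field set"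
  by (simp add: gen_poly_def degree_prod_linear[of "\<lambda>x. x"])

lemma gen_poly_nonzero: "gen_poly Z \<noteq> 0" for Z :: "'a::field set"
  by (cases "finite Z") (auto simp: gen_poly_def)

lemma degree_monom_minus_one: "n > 0 \<Longrightarrow> degree (monom 1 n - 1 :: 'a::field poly) = n"
  using degree_add_eq_left[of "-1" "monom 1 n :: 'a poly"] by (simp add: degree_monom_eq)

lemma gen_poly_dvd_monom_minus_one:
  fixes Z :: "'a::field set"
  assumes "finite Z" "Z \<subseteq> {\<beta>. \<beta> ^ n = 1}"
  shows "gen_poly Z dvd monom 1 n - 1"
  using assms by (auto simp: gen_poly_dvd_iff poly_monom)

text \<open>The generator divides \<open>x^n - 1\<close>, so reduction preserves divisibility by it;
  conversely, a polynomial of degree below \<open>n\<close> is its own remainder.\<close>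

lemma cyclic_code_iff_dvd:
  fixes Z :: "'a::field set"
  assumes n: "n > 0" and Z: "finite Z" "Z \<subseteq> {\<beta>. \<beta> ^ n = 1}"
  shows "c \<in> cyclic_code n Z \<longleftrightarrow> c \<in> vecs n \<and> gen_poly Z dvd vec_poly n c"
proof -
  have "degree (vec_poly n c) < n"
    using n by (intro degree_lessI) (auto simp: coeff_vec_poly)
  then have mod: "vec_poly n c mod (monom 1 n - 1) = vec_poly n c"
    using n by (intro mod_poly_less) (simp add: degree_monom_minus_one)
  have "gen_poly Z dvd vec_poly n c"
    if "vec_poly n c = (f * gen_poly Z) mod (monom 1 n - 1)" for f
    unfolding that using gen_poly_dvd_monom_minus_one[OF Z] by (intro dvd_mod) auto
  then show ?thesis
    unfolding cyclic_code_def using mod by (auto simp: dvd_def mult.commute) metis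
qed

lemma cyclic_code_iff:
  fixes Z :: "'a::field set"
  assumes "n > 0" "finite Z" "Z \<subseteq> {\<beta>. \<beta> ^ n = 1}"
  shows "c \<in> cyclic_code n Z \<longleftrightarrow> c \<in> vecs n \<and> (\<forall>\<beta>\<in>Z. (\<Sum>i<n. c i * \<beta> ^ i) = 0)"
  using assms(2) by (simp add: cyclic_code_iff_dvd[OF assms] gen_poly_dvd_iff poly_vec_poly)

lemma cyclic_code_subset_vecs: "cyclic_code n Z \<subseteq> vecs n"
  by (auto simp: cyclic_code_def)

lemma subspace_cyclic_code:
  fixes Z :: "'a::field set"
  assumes "n > 0" "finite Z" "Z \<subseteq> {\<beta>. \<beta> ^ n = 1}"
  shows "fun_space.subspace (cyclic_code n Z)"
proof (rule fun_space.subspaceI)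
  show "0 \<in> cyclic_code n Z" by (simp add: cyclic_code_iff[OF assms] vecs_def)
next
  fix x y assume "x \<in> cyclic_code n Z" "y \<in> cyclic_code n Z"
  then show "x + y \<in> cyclic_code n Z"
    by (simp add: cyclic_code_iff[OF assms] vecs_def algebra_simps sum.distrib)
next
  fix a x assume "x \<in> cyclic_code n Z"
  then show "(\<lambda>i. a * x i) \<in> cyclic_code n Z"
    by (simp add: cyclic_code_iff[OF assms] vecs_def mult.assoc flip: sum_distrib_left)
qed

text \<open>The basis consists of the \<open>n - card Z\<close> shifts of the generator that still
  have degree below \<open>n\<close>.\<close>

theorem code_dim_cyclic_code:
  fixes Z :: "'a::field set"
  assumes n: "n > 0" and Z: "finite Z" "Z \<subseteq> {\<beta>. \<beta> ^ n = 1}"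
  shows "code_dim (cyclic_code n Z) = n - card Z"
proof -
  let ?g = "gen_poly Z" and ?k = "n - card Z"
  define E where "E j = coeff (monom 1 j * ?g)" for j
  have degE: "degree (monom 1 j * ?g) = j + card Z" for j
    using gen_poly_nonzero[of Z] by (subst degree_mult_eq) (auto simp: degree_monom_eq degree_gen_poly)
  have E_code: "E j \<in> cyclic_code n Z" if "j < ?k" for j
  proof -
    have "coeff (monom 1 j * ?g) \<in> vecs n"
      using that by (auto simp: vecs_def degE intro!: coeff_eq_0)
    then show ?thesis
      unfolding cyclic_code_iff_dvd[OF n Z] E_def by (simp add: vec_poly_coeff)
  qed
  have inj: "inj_on E X" for X
  proof (rule inj_onI)
    fix i j assume "E i = E j"
    then have "monom 1 i * ?g = monom 1 j * ?g" by (simp add: E_def coeff_inject)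
    then show "i = j" using degE[of i] degE[of j] by (metis add_right_cancel)
  qed
  have span: "c \<in> fun_space.span (E ` {..<?k})" if c: "c \<in> cyclic_code n Z" for c
  proof -
    from c obtain f where f: "vec_poly n c = ?g * f" and cv: "c \<in> vecs n"
      by (auto simp: cyclic_code_iff_dvd[OF n Z] elim: dvdE)
    have "coeff f i = 0" if "i \<ge> ?k" for i
    proof (cases "f = 0")
      case False
      then have "degree (vec_poly n c) = card Z + degree f"
        unfolding f using gen_poly_nonzero[of Z] by (subst degree_mult_eq) (auto simp: degree_gen_poly)
      moreover have "degree (vec_poly n c) < n"
        using n by (intro degree_lessI) (auto simp: coeff_vec_poly)
      ultimately show ?thesis using that by (intro coeff_eq_0) simp
    qed simp
    then have "vec_poly ?k (coeff f) = f" by (intro vec_poly_coeff) (simp add: vecs_def)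
    then have "c = coeff (vec_poly ?k (coeff f) * ?g)"
      using f coeff_vec_poly_vecs[OF cv] by (simp add: mult.commute)
    also have "\<dots> = (\<Sum>j<?k. (\<lambda>i. coeff f j * E j i))"
      by (rule ext) (simp add: coeff_vec_poly_mult E_def sum_fun_apply)
    also have "\<dots> \<in> fun_space.span (E ` {..<?k})"
      by (intro fun_space.span_sum fun_space.span_scale fun_space.span_base) auto
    finally show ?thesis .
  qed
  have "fun_space.independent (E ` {..<?k})"
  proof
    assume "fun_space.dependent (E ` {..<?k})"
    then obtain u j where j: "j < ?k" "u (E j) \<noteq> 0"
      and "(\<Sum>v\<in>E ` {..<?k}. (\<lambda>i. u v * v i)) = 0"
      by (subst (asm) fun_space.dependent_finite) auto
    then have sum0: "(\<Sum>j<?k. (\<lambda>i. u (E j) * E j i)) = 0"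
      by (simp add: sum.reindex[OF inj])
    have "coeff (vec_poly ?k (\<lambda>j. u (E j)) * ?g) i = 0" for i
      using fun_cong[OF sum0, of i] by (simp add: coeff_vec_poly_mult E_def sum_fun_apply)
    then have "vec_poly ?k (\<lambda>j. u (E j)) * ?g = 0" by (simp add: poly_eq_iff)
    then have "vec_poly ?k (\<lambda>j. u (E j)) = 0" using gen_poly_nonzero[of Z] by simp
    then have "coeff (vec_poly ?k (\<lambda>j. u (E j))) j = 0" by simp
    then show False using j by (simp add: coeff_vec_poly)
  qed
  then show ?thesis unfolding code_dim_def
    using E_code span by (intro fun_space.dim_unique[of "E ` {..<?k}"]) (auto simp: card_image[OF inj])
qed

section \<open>Primitive roots of unity and the BCH bound\<close>

lemma prim_root_power_eq_one_iff:
  assumes "prim_root n \<gamma>" "n > 0"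
  shows "\<gamma> ^ k = 1 \<longleftrightarrow> n dvd k"
proof
  assume "\<gamma> ^ k = 1"
  moreover have "\<gamma> ^ k = (\<gamma> ^ n) ^ (k div n) * \<gamma> ^ (k mod n)"
    by (simp flip: power_mult power_add)
  ultimately have "\<gamma> ^ (k mod n) = 1" using assms by (simp add: prim_root_def)
  then have "k mod n = 0"
    using assms unfolding prim_root_def by (metis gr0I mod_less_divisor)
  then show "n dvd k" by auto
next
  assume "n dvd k"
  then show "\<gamma> ^ k = 1" using assms by (auto simp: prim_root_def power_mult elim!: dvdE)
qed

lemma prim_root_power_coprime:
  assumes "prim_root n \<gamma>" "n > 0" "coprime b n"
  shows "prim_root n (\<gamma> ^ b)"
proof -
  have "(\<gamma> ^ b) ^ k = 1 \<longleftrightarrow> n dvd k" for k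
    using assms by (simp add: prim_root_power_eq_one_iff coprime_dvd_mult_right_iff coprime_commute
      flip: power_mult)
  then show ?thesis by (auto simp: prim_root_def dest: dvd_imp_le)
qed

lemma prim_root_inverse: "prim_root n \<gamma> \<Longrightarrow> prim_root n (inverse \<gamma>)"
  by (simp add: prim_root_def power_inverse)

lemma prim_root_nonzero: "prim_root n \<gamma> \<Longrightarrow> n > 0 \<Longrightarrow> \<gamma> \<noteq> 0"
  by (auto simp: prim_root_def power_0_left)

lemma inj_on_prim_root_power:
  assumes "prim_root n \<gamma>" "n > 0"
  shows "inj_on (\<lambda>i. \<gamma> ^ i) {..<n}"
proof -
  have "i = j" if "\<gamma> ^ i = \<gamma> ^ j" "i \<le> j" "j < n" for i j
  proof -
    have "\<gamma> ^ i * \<gamma> ^ (j - i) = \<gamma> ^ j" using that(2) by (simp flip: power_add)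
    also have "\<dots> = \<gamma> ^ i * 1" using that(1) by simp
    finally have "\<gamma> ^ i * \<gamma> ^ (j - i) = \<gamma> ^ i * 1" .
    then have "\<gamma> ^ (j - i) = 1" using prim_root_nonzero[OF assms] by simp
    then have "n dvd j - i" using prim_root_power_eq_one_iff[OF assms] by simp
    then show "i = j" using that by (auto dest: dvd_imp_le)
  qed
  then show ?thesis by (metis inj_onI lessThan_iff nle_le)
qed

text \<open>Reads an evaluation as a power moment with locators \<open>\<gamma> ^ i\<close> and
  weights \<open>v i * a ^ i\<close>. The sum is cut down to the support so that the number of nodes
  is the Hamming weight.\<close>

lemma eval_eq_moment:
  fixes v :: "nat \<Rightarrow> 'a::field"
  shows "(\<Sum>i<n. v i * (a * \<gamma> ^ p) ^ i) = (\<Sum>i | i < n \<and> v i \<noteq> 0. (v i * a ^ i) * (\<gamma> ^ i) ^ p)"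
proof -
  have "(\<Sum>i<n. v i * (a * \<gamma> ^ p) ^ i) = (\<Sum>i<n. (v i * a ^ i) * (\<gamma> ^ i) ^ p)"
    by (simp add: power_mult_distrib mult_ac flip: power_mult)
  also have "\<dots> = (\<Sum>i | i < n \<and> v i \<noteq> 0. (v i * a ^ i) * (\<gamma> ^ i) ^ p)"
    by (rule sum.mono_neutral_right) auto
  finally show ?thesis .
qed

text \<open>For a weight below \<open>\<delta>\<close>, the \<open>\<delta> - 1\<close> consecutive
  zeros would supply all moments that the Vandermonde argument needs.\<close>

theorem bch_bound:
  fixes v :: "nat \<Rightarrow> 'a::field"
  assumes \<gamma>: "prim_root n \<gamma>" "n > 0" and a: "a \<noteq> 0" and v: "j < n" "v j \<noteq> 0"
    and zero: "\<And>p. p + 1 < \<delta> \<Longrightarrow> (\<Sum>i<n. v i * (a * \<gamma> ^ p) ^ i) = 0"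
  shows "\<delta> \<le> hweight n v"
proof (rule ccontr)
  assume less: "\<not> \<delta> \<le> hweight n v"
  have "v j * a ^ j = 0"
  proof (rule vanishing_moments_imp_zero[of "{i. i < n \<and> v i \<noteq> 0}" "\<lambda>i. \<gamma> ^ i" "\<lambda>i. v i * a ^ i"])
    show "inj_on (\<lambda>i. \<gamma> ^ i) {i. i < n \<and> v i \<noteq> 0}"
      using inj_on_prim_root_power[OF \<gamma>] by (rule inj_on_subset) auto
    show "(\<Sum>i | i < n \<and> v i \<noteq> 0. (v i * a ^ i) * (\<gamma> ^ i) ^ p) = 0"
      if "p < card {i. i < n \<and> v i \<noteq> 0}" for p
      using zero[of p] that less by (simp add: eval_eq_moment hweight_def)
  qed (use v in auto)
  then show False using a v by simp
qed

section \<open>Products of defining sets, cyclic shifts and locality\<close>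

lemma finite_set_mult:
  assumes "finite A" "finite B"
  shows "finite (set_mult A B)"
proof -
  have "set_mult A B = (\<lambda>(x, y). x * y) ` (A \<times> B)" by (auto simp: set_mult_def)
  then show ?thesis using assms by simp
qed

lemma set_mult_roots:
  fixes A B :: "'a::comm_monoid_mult set"
  assumes "A \<subseteq> {\<beta>. \<beta> ^ n = 1}" "B \<subseteq> {\<beta>. \<beta> ^ n = 1}"
  shows "set_mult A B \<subseteq> {\<beta>. \<beta> ^ n = 1}"
proof
  fix z assume "z \<in> set_mult A B"
  then obtain x y where "z = x * y" "x \<in> A" "y \<in> B" by (auto simp: set_mult_def)
  moreover from this have "x ^ n = 1" "y ^ n = 1" using assms by auto
  ultimately show "z \<in> {\<beta>. \<beta> ^ n = 1}" by (simp add: power_mult_distrib)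
qed

text \<open>Twisting \<open>c\<close> by the powers of \<open>\<beta>\<close> turns its zeros
  \<open>x * \<beta>\<close> into zeros \<open>x\<close>. The twisted word therefore lies in the
  code of \<open>A\<close> and is orthogonal to \<open>v\<close>.\<close>

lemma dual_cyclic_code_mult:
  fixes A B :: "'a::field set"
  assumes n: "n > 0" and A: "finite A" "A \<subseteq> {\<beta>. \<beta> ^ n = 1}"
    and B: "finite B" "B \<subseteq> {\<beta>. \<beta> ^ n = 1}"
    and v: "v \<in> dual_code n (cyclic_code n A)" and c: "c \<in> cyclic_code n (set_mult A B)"
    and \<beta>: "\<beta> \<in> B"
  shows "(\<Sum>i<n. (c i * v i) * \<beta> ^ i) = 0"
proof -
  have AB: "finite (set_mult A B)" "set_mult A B \<subseteq> {\<beta>. \<beta> ^ n = 1}"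
    using A B by (simp_all add: finite_set_mult set_mult_roots)
  have "(\<lambda>i. c i * \<beta> ^ i) \<in> cyclic_code n A"
    unfolding cyclic_code_iff[OF n A]
  proof (intro conjI ballI)
    show "(\<lambda>i. c i * \<beta> ^ i) \<in> vecs n" using c by (simp add: cyclic_code_def vecs_def)
    fix x assume x: "x \<in> A"
    then have "x * \<beta> \<in> set_mult A B" using \<beta> by (auto simp: set_mult_def)
    then have "(\<Sum>i<n. c i * (x * \<beta>) ^ i) = 0"
      using c by (simp add: cyclic_code_iff[OF n AB])
    then show "(\<Sum>i<n. c i * \<beta> ^ i * x ^ i) = 0" by (simp add: power_mult_distrib mult_ac)
  qed
  then have "(\<Sum>i<n. (c i * \<beta> ^ i) * v i) = 0" using v by (auto simp: dual_code_def)
  then show ?thesis by (simp add: mult_ac)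
qed

lemma mod_shift_cancel:
  fixes i s n :: nat
  assumes "s < n" "i < n"
  shows "((i + s) mod n + (n - s)) mod n = i" "((i + (n - s)) mod n + s) mod n = i"
proof -
  have "((i + s) mod n + (n - s)) mod n = (i + s + (n - s)) mod n"
    "((i + (n - s)) mod n + s) mod n = (i + (n - s) + s) mod n" by (rule mod_add_left_eq)+
  then show "((i + s) mod n + (n - s)) mod n = i" "((i + (n - s)) mod n + s) mod n = i"
    using assms by simp_all
qed

lemma sum_cyclic_shift:
  fixes f :: "nat \<Rightarrow> 'b::comm_monoid_add"
  assumes "s < n"
  shows "(\<Sum>i<n. f ((i + s) mod n)) = (\<Sum>i<n. f i)"
proof (rule sum.reindex_bij_witness[where i = "\<lambda>j. (j + (n - s)) mod n" and j = "\<lambda>i. (i + s) mod n"])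
qed (use assms in \<open>auto simp del: add_diff_assoc add_diff_assoc2 simp: mod_shift_cancel\<close>)

definition cyclic_shift :: "nat \<Rightarrow> nat \<Rightarrow> (nat \<Rightarrow> 'a::zero) \<Rightarrow> nat \<Rightarrow> 'a" where
  "cyclic_shift n s v i = (if i < n then v ((i + s) mod n) else 0)"

text \<open>The adjoint of a shift is the opposite shift, which carries shift invariance over to the
  dual code. The \<open>mod n\<close> keeps the shift below \<open>n\<close> when
  \<open>s = 0\<close>.\<close>

lemma sum_cyclic_shift_mult:
  fixes c v :: "nat \<Rightarrow> 'a::field"
  assumes "s < n"
  shows "(\<Sum>i<n. c i * cyclic_shift n s v i) = (\<Sum>i<n. cyclic_shift n ((n - s) mod n) c i * v i)"
proof -
  have "(\<Sum>i<n. cyclic_shift n ((n - s) mod n) c i * v i) =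
      (\<Sum>i<n. cyclic_shift n ((n - s) mod n) c ((i + s) mod n) * v ((i + s) mod n))"
    using sum_cyclic_shift[OF assms, of "\<lambda>i. cyclic_shift n ((n - s) mod n) c i * v i"] by simp
  also have "\<dots> = (\<Sum>i<n. c i * cyclic_shift n s v i)"
  proof (intro sum.cong refl)
    fix i assume "i \<in> {..<n}"
    then show "cyclic_shift n ((n - s) mod n) c ((i + s) mod n) * v ((i + s) mod n) = c i * cyclic_shift n s v i"
      using assms mod_shift_cancel(1)[OF assms, of i]
      by (simp add: cyclic_shift_def mod_add_right_eq del: add_diff_assoc)
  qed
  finally show ?thesis by simp
qed

lemma cyclic_shift_cyclic_code:
  fixes Z :: "'a::field set"
  assumes n: "n > 0" and Z: "finite Z" "Z \<subseteq> {\<beta>. \<beta> ^ n = 1}"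
    and c: "c \<in> cyclic_code n Z" and s: "s < n"
  shows "cyclic_shift n s c \<in> cyclic_code n Z"
  unfolding cyclic_code_iff[OF n Z]
proof (intro conjI ballI)
  show "cyclic_shift n s c \<in> vecs n" by (simp add: vecs_def cyclic_shift_def)
  fix \<beta> assume \<beta>: "\<beta> \<in> Z"
  have \<beta>mod: "\<beta> ^ (j mod n) = \<beta> ^ j" for j
  proof -
    have "\<beta> ^ j = (\<beta> ^ n) ^ (j div n) * \<beta> ^ (j mod n)" by (simp flip: power_mult power_add)
    then show ?thesis using Z(2) \<beta> by auto
  qed
  \<comment> \<open>The factor \<open>\<beta> ^ s\<close> raises the exponents to
    \<open>i + s\<close>, which may then be reduced modulo \<open>n\<close>; it is cancelled at the
    end because \<open>\<beta>\<close> is nonzero.\<close>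
  have "\<beta> ^ s * (\<Sum>i<n. cyclic_shift n s c i * \<beta> ^ i) = (\<Sum>i<n. c ((i + s) mod n) * \<beta> ^ ((i + s) mod n))"
    by (simp add: cyclic_shift_def \<beta>mod power_add sum_distrib_left mult_ac)
  also have "\<dots> = (\<Sum>i<n. c i * \<beta> ^ i)" by (rule sum_cyclic_shift[OF s])
  also have "\<dots> = 0" using c \<beta> by (simp add: cyclic_code_iff[OF n Z])
  finally show "(\<Sum>i<n. cyclic_shift n s c i * \<beta> ^ i) = 0"
    using Z(2) \<beta> n by (auto simp: power_0_left)
qed

lemma cyclic_shift_dual_code:
  fixes Z :: "'a::field set"
  assumes n: "n > 0" and Z: "finite Z" "Z \<subseteq> {\<beta>. \<beta> ^ n = 1}"
    and v: "v \<in> dual_code n (cyclic_code n Z)" and s: "s < n"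
  shows "cyclic_shift n s v \<in> dual_code n (cyclic_code n Z)"
proof -
  have "(\<Sum>i<n. c i * cyclic_shift n s v i) = 0" if "c \<in> cyclic_code n Z" for c
    using cyclic_shift_cyclic_code[OF n Z that, of "(n - s) mod n"] v n
    by (simp add: sum_cyclic_shift_mult[OF s] dual_code_def)
  then show ?thesis by (simp add: dual_code_def vecs_def cyclic_shift_def)
qed

lemma hweight_cyclic_shift:
  assumes "s < n"
  shows "hweight n (cyclic_shift n s v) = hweight n v"
proof -
  have hw: "hweight n w = (\<Sum>i<n. if w i \<noteq> 0 then 1 else 0)" for w :: "nat \<Rightarrow> 'a"
    by (simp add: hweight_def sum.If_cases lessThan_def Collect_conj_eq)
  show ?thesis
    unfolding hw using sum_cyclic_shift[OF assms, of "\<lambda>i. if v i \<noteq> 0 then 1 else 0 :: nat"]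
    by (simp add: cyclic_shift_def)
qed

text \<open>The local groups are the supports of the shifts of \<open>v\<close>. By
  \<open>wt\<close> the subtraction does not truncate, so the allowed group size is exactly the
  weight of \<open>v\<close>.\<close>

theorem cyclic_code_set_mult_is_LRC:
  fixes A B :: "'a::field set"
  assumes n: "n > 0" and A: "finite A" "A \<subseteq> {\<beta>. \<beta> ^ n = 1}"
    and \<gamma>: "prim_root n \<gamma>" and \<delta>: "\<delta> \<ge> 2"
    and v: "v \<in> dual_code n (cyclic_code n A)" "v \<noteq> 0" and wt: "\<delta> \<le> hweight n v"
  shows "is_LRC n (cyclic_code n (set_mult A {\<gamma> ^ j | j. j \<le> \<delta> - 2})) (hweight n v - \<delta> + 1) \<delta>"
    (is "is_LRC n ?C ?r \<delta>")
proof -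
  define B where "B = {\<gamma> ^ j | j. j \<le> \<delta> - 2}"
  have "B = (\<lambda>j. \<gamma> ^ j) ` {..\<delta> - 2}" by (auto simp: B_def)
  then have B: "finite B" "B \<subseteq> {\<beta>. \<beta> ^ n = 1}"
    using \<gamma> by (auto simp: prim_root_def power_commutes) (metis mult.commute power_mult power_one)
  obtain j where j: "v j \<noteq> 0" using v(2) by (auto simp: fun_eq_iff)
  then have jn: "j < n" using v(1) by (auto simp: dual_code_def vecs_def not_less[symmetric])
  have "has_locality n ?C ?r \<delta> i" if i: "i < n" for i
  proof -
    \<comment> \<open>Chosen as \<open>j - i\<close> modulo \<open>n\<close>, so that entry
      \<open>i\<close> of the shifted word is the nonzero \<open>v j\<close>.\<close>
    define s where "s = (j + (n - i)) mod n"
    define w where "w = cyclic_shift n s v"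
    define S where "S = {l. l < n \<and> w l \<noteq> 0}"
    have s: "s < n" using n by (simp add: s_def)
    have "(i + s) mod n = j" using mod_shift_cancel(2)[OF i jn]
      by (simp add: s_def add.commute)
    then have "i \<in> S" using i j by (simp add: S_def w_def cyclic_shift_def)
    moreover have "card S \<le> ?r + \<delta> - 1"
      using hweight_cyclic_shift[OF s, of v] wt by (simp add: S_def hweight_def w_def)
    moreover have "\<delta> \<le> card {l\<in>S. c l \<noteq> 0}" if c: "c \<in> ?C" and l: "l \<in> S" "c l \<noteq> 0" for c l
    proof -
      have wd: "w \<in> dual_code n (cyclic_code n A)"
        unfolding w_def by (rule cyclic_shift_dual_code[OF n A v(1) s])
      have "\<delta> \<le> hweight n (\<lambda>i. c i * w i)"
      proof (rule bch_bound[OF \<gamma> n, of 1])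
        show "(\<Sum>i<n. c i * w i * (1 * \<gamma> ^ p) ^ i) = 0" if "p + 1 < \<delta>" for p
        proof -
          have "p \<le> \<delta> - 2" using that by simp
          then have "\<gamma> ^ p \<in> B" by (auto simp: B_def)
          then show ?thesis
            using dual_cyclic_code_mult[OF n A B wd, of c "\<gamma> ^ p"] c by (simp add: B_def)
        qed
        show "l < n" "c l * w l \<noteq> 0" using l by (auto simp: S_def)
      qed simp
      also have "\<dots> = card {l\<in>S. c l \<noteq> 0}"
        unfolding hweight_def by (rule arg_cong[of _ _ card]) (auto simp: S_def)
      finally show ?thesis .
    qed
    ultimately show ?thesis
      unfolding has_locality_iff by (intro exI[of _ S]) (auto simp: S_def)
  qed
  then show ?thesis using \<delta> by (simp add: is_LRC_def)
qed

section \<open>Zeros and nonzero words of the dual code\<close>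

lemma sum_powers_root_of_unity:
  fixes x :: "'a::field"
  assumes "x ^ n = 1" "x \<noteq> 1"
  shows "(\<Sum>i<n. x ^ i) = 0"
  using assms power_diff_1_eq[of x n] by (simp add: lessThan_def)

text \<open>The word of powers of \<open>inverse \<beta>\<close> lies in the code, since its
  evaluation at each \<open>z\<close> in \<open>Z\<close> is a geometric sum over the root of unity
  \<open>z / \<beta>\<close>, which is not 1. It is thus a parity check for
  \<open>v\<close>.\<close>

lemma dual_cyclic_code_zeros:
  fixes Z :: "'a::field set"
  assumes n: "n > 0" and Z: "finite Z" "Z \<subseteq> {\<beta>. \<beta> ^ n = 1}"
    and v: "v \<in> dual_code n (cyclic_code n Z)" and \<beta>: "\<beta> ^ n = 1" "\<beta> \<notin> Z"
  shows "(\<Sum>i<n. v i * inverse \<beta> ^ i) = 0"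
proof -
  have \<beta>0: "\<beta> \<noteq> 0" using \<beta> n by (auto simp: power_0_left)
  define c where "c i = (if i < n then inverse \<beta> ^ i else 0)" for i
  have "(\<Sum>i<n. c i * z ^ i) = 0" if z: "z \<in> Z" for z
  proof -
    have "(\<Sum>i<n. c i * z ^ i) = (\<Sum>i<n. (z / \<beta>) ^ i)"
      by (simp add: c_def power_divide field_simps)
    also have "\<dots> = 0"
      using Z(2) \<beta> \<beta>0 z by (intro sum_powers_root_of_unity) (auto simp: power_divide)
    finally show ?thesis .
  qed
  then have "c \<in> cyclic_code n Z" by (simp add: cyclic_code_iff[OF n Z] vecs_def c_def)
  then have "(\<Sum>i<n. c i * v i) = 0" using v by (simp add: dual_code_def)
  then show ?thesis by (simp add: c_def mult.commute)
qed

text \<open>The powers of any element of \<open>Z\<close> form a parity check. This makes the dual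
  distance finite, so that \<open>the_enat\<close> returns a genuine weight.\<close>

lemma dual_cyclic_code_nonzero:
  fixes Z :: "'a::field set"
  assumes n: "n > 0" and Z: "finite Z" "Z \<subseteq> {\<beta>. \<beta> ^ n = 1}" "Z \<noteq> {}"
  obtains v where "v \<in> dual_code n (cyclic_code n Z)" "v \<noteq> 0"
proof -
  obtain \<beta> where \<beta>: "\<beta> \<in> Z" using Z(3) by auto
  define v where "v i = (if i < n then \<beta> ^ i else 0)" for i
  have "v \<in> dual_code n (cyclic_code n Z)"
    using \<beta> cyclic_code_iff[OF n Z(1,2)] by (auto simp: dual_code_def vecs_def v_def)
  moreover have "v 0 = 1" using n by (simp add: v_def)
  then have "v \<noteq> 0" by auto
  ultimately show ?thesis by (rule that)
qed

subsection \<open>The exponents of the defining sets\<close>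

definition exps_A :: "nat \<Rightarrow> nat \<Rightarrow> nat set" where
  "exps_A m \<delta> = {j. j \<le> (m - 1) * \<delta> + 1} \<union> {(m + e) * \<delta> + 1 | e. e \<le> m}"

text \<open>The conditions copy the hypothesis on the moments in
  \<open>betti_sala_bound\<close>.\<close>

definition exps_AB :: "nat \<Rightarrow> nat \<Rightarrow> nat set" where
  "exps_AB m \<delta> = {j. j < (2 * m + 1) * \<delta> \<and> \<not> (\<delta> dvd j \<and> m * \<delta> \<le> j)}"

lemma exps_A_subset: "\<delta> \<ge> 2 \<Longrightarrow> exps_A m \<delta> \<subseteq> {..<(2 * m + 1) * \<delta>}"
proof
  fix j assume \<delta>: "\<delta> \<ge> 2" and "j \<in> exps_A m \<delta>"
  then consider "j \<le> (m - 1) * \<delta> + 1" | e where "j = (m + e) * \<delta> + 1" "e \<le> m"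
    by (auto simp: exps_A_def)
  then show "j \<in> {..<(2 * m + 1) * \<delta>}"
  proof cases
    case 1
    moreover have "(m - 1) * \<delta> \<le> 2 * m * \<delta>" by (intro mult_right_mono) auto
    ultimately show ?thesis using \<delta> by (simp add: algebra_simps)
  next
    case 2
    then have "(m + e) * \<delta> \<le> (2 * m) * \<delta>" by (intro mult_right_mono) auto
    moreover have "(2 * m + 1) * \<delta> = (2 * m) * \<delta> + \<delta>" by simp
    ultimately have "j < (2 * m + 1) * \<delta>" using 2(1) \<delta> by linarith
    then show ?thesis by simp
  qed
qed

text \<open>Adding up to \<open>\<delta> - 2\<close> extends the initial run to
  \<open>m * \<delta> - 1\<close> and each isolated exponent \<open>(m + e) * \<delta> + 1\<close>
  to a run ending just before the next multiple of \<open>\<delta>\<close>.\<close>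

lemma exps_AB_eq_sums:
  assumes m: "m \<ge> 1" and \<delta>: "\<delta> \<ge> 2"
  shows "exps_AB m \<delta> = {i + j | i j. i \<in> exps_A m \<delta> \<and> j \<le> \<delta> - 2}" (is "_ = ?R")
proof (intro equalityI subsetI)
  have m\<delta>: "m * \<delta> = (m - 1) * \<delta> + \<delta>" using m by (cases m) auto
  {
    fix x assume "x \<in> ?R"
    then obtain i j where x: "x = i + j" "i \<in> exps_A m \<delta>" "j \<le> \<delta> - 2" by auto
    then consider "i \<le> (m - 1) * \<delta> + 1" | e where "i = (m + e) * \<delta> + 1" "e \<le> m"
      by (auto simp: exps_A_def)
    then show "x \<in> exps_AB m \<delta>"
    proof cases
      case 1
      then have "x < m * \<delta>" using x \<delta> m\<delta> by linarith
      moreover have "m * \<delta> \<le> (2 * m + 1) * \<delta>" by (intro mult_right_mono) auto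
      ultimately show ?thesis by (simp add: exps_AB_def)
    next
      case 2
      have eq: "x = (m + e) * \<delta> + (j + 1)" using 2 x by simp
      have "x < (m + e) * \<delta> + \<delta>" using eq x(3) \<delta> by linarith
      also have "\<dots> = (m + e + 1) * \<delta>" by simp
      also have "\<dots> \<le> (2 * m + 1) * \<delta>" using 2 by (intro mult_right_mono) auto
      finally have "x < (2 * m + 1) * \<delta>" .
      moreover have "\<not> \<delta> dvd j + 1" using x(3) \<delta> by (auto dest: dvd_imp_le)
      then have "\<not> \<delta> dvd x" unfolding eq by (subst dvd_add_right_iff) auto
      ultimately show ?thesis by (simp add: exps_AB_def)
    qed
  next
    fix x assume x: "x \<in> exps_AB m \<delta>"
    consider "x \<le> (m - 1) * \<delta> + 1" | "(m - 1) * \<delta> + 1 < x" "x < m * \<delta>" | "m * \<delta> \<le> x"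
      by linarith
    then show "x \<in> ?R"
    proof cases
      case 1
      then have "x \<in> exps_A m \<delta>" by (simp add: exps_A_def)
      moreover have "x = x + 0" "0 \<le> \<delta> - 2" by simp_all
      ultimately show ?thesis by blast
    next
      case 2
      have "(m - 1) * \<delta> + 1 \<in> exps_A m \<delta>" by (simp add: exps_A_def)
      moreover have "x = ((m - 1) * \<delta> + 1) + (x - ((m - 1) * \<delta> + 1))"
        "x - ((m - 1) * \<delta> + 1) \<le> \<delta> - 2" using 2 m\<delta> by linarith+
      ultimately show ?thesis by blast
    next
      case 3
      define q s where "q = x div \<delta>" and "s = x mod \<delta>"
      have xq: "x = q * \<delta> + s" by (simp add: q_def s_def)
      have s: "s < \<delta>" "s \<noteq> 0" using \<delta> x 3 by (auto simp: s_def exps_AB_def mod_eq_0_iff_dvd)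
      have "m \<le> q" using 3 \<delta> by (simp add: q_def less_eq_div_iff_mult_less_eq)
      moreover have "q < 2 * m + 1"
        unfolding q_def by (rule less_mult_imp_div_less) (use x in \<open>simp add: exps_AB_def\<close>)
      ultimately have "q = m + (q - m)" "q - m \<le> m" by simp_all
      then have "q * \<delta> + 1 \<in> {(m + e) * \<delta> + 1 | e. e \<le> m}" by (metis (mono_tags, lifting) mem_Collect_eq)
      then have "q * \<delta> + 1 \<in> exps_A m \<delta>" unfolding exps_A_def by (rule UnI2)
      moreover have "x = (q * \<delta> + 1) + (s - 1)" "s - 1 \<le> \<delta> - 2" using xq s by linarith+
      ultimately show ?thesis by blast
    qed
  }
qed

lemma card_exps_AB:
  assumes \<delta>: "\<delta> \<ge> 2"
  shows "card (exps_AB m \<delta>) = m * \<delta> + (m + 1) * (\<delta> - 1)"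
proof -
  have "exps_AB m \<delta> = {..<(2 * m + 1) * \<delta>} - (\<lambda>q. q * \<delta>) ` {m..2 * m}"
  proof (intro equalityI subsetI)
    fix x assume x: "x \<in> {..<(2 * m + 1) * \<delta>} - (\<lambda>q. q * \<delta>) ` {m..2 * m}"
    have False if "\<delta> dvd x" "m * \<delta> \<le> x"
    proof -
      obtain q where q: "x = q * \<delta>" using \<open>\<delta> dvd x\<close> by (metis dvd_def mult.commute)
      have "q * \<delta> < (2 * m + 1) * \<delta>" "m * \<delta> \<le> q * \<delta>" using x that q by simp_all
      then have "q < 2 * m + 1" "m \<le> q" using \<delta> by (simp_all only: mult_less_cancel2 mult_le_cancel2)
      then have "q \<in> {m..2 * m}" by simp
      then show False using x q by blast
    qed
    then show "x \<in> exps_AB m \<delta>" using x by (auto simp: exps_AB_def)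
  qed (auto simp: exps_AB_def)
  moreover have "(\<lambda>q. q * \<delta>) ` {m..2 * m} \<subseteq> {..<(2 * m + 1) * \<delta>}"
    using \<delta> by (auto simp del: mult_Suc simp: mult_less_cancel2 simp flip: mult_Suc)
  moreover have "inj_on (\<lambda>q. q * \<delta>) {m..2 * m}" using \<delta> by (auto simp: inj_on_def)
  ultimately have "card (exps_AB m \<delta>) = (2 * m + 1) * \<delta> - (m + 1)"
    by (simp add: card_Diff_subset card_image)
  also have "\<dots> = m * \<delta> + (m + 1) * (\<delta> - 1)"
    using \<delta> by (cases \<delta>) (auto simp: algebra_simps)
  finally show ?thesis .
qed

theorem theorem4p7:
  fixes \<alpha> :: "'a::{finite,field}"
    and n b m \<delta> t :: nat
  assumes "n dvd (card (UNIV :: 'a set) - 1)"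
    and "prim_root n \<alpha>"
    and "b \<ge> 1" and "m \<ge> 1" and "\<delta> \<ge> 2"
    and "coprime b n"
    and "n \<ge> (2 * m + 1) * \<delta>"
    and "t < n"
  defines "B \<equiv> {\<alpha> ^ (j * b) | j. j \<le> \<delta> - 2}"
    and "A \<equiv> {\<alpha> ^ (t + j * b) | j. j \<le> (m - 1) * \<delta> + 1}
              \<union> {\<alpha> ^ (t + ((m + e) * \<delta> + 1) * b) | e. e \<le> m}"
  defines "r \<equiv> the_enat (min_dist n (dual_code n (cyclic_code n A))) - \<delta> + 1"
    and "k \<equiv> n - m * \<delta> - (m + 1) * (\<delta> - 1)"
  shows "is_LRC n (cyclic_code n (set_mult A B)) r \<delta>
         \<and> code_dim (cyclic_code n (set_mult A B)) = k
         \<and> (\<lceil>real k / real r\<rceil> = int (m + 1) \<longrightarrow>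
              is_optimal_LRC n (cyclic_code n (set_mult A B)) r \<delta>
              \<and> min_dist n (cyclic_code n (set_mult A B)) = enat ((m + 1) * \<delta>))"
proof -
  define \<gamma> a where "\<gamma> = \<alpha> ^ b" and "a = \<alpha> ^ t"
  let ?x = "\<lambda>j. a * \<gamma> ^ j"
  let ?C = "cyclic_code n (set_mult A B)"
  have n: "n > 0" using \<open>t < n\<close> by simp
  have \<gamma>: "prim_root n \<gamma>"
    unfolding \<gamma>_def using assms n by (intro prim_root_power_coprime)
  have \<gamma>0: "\<gamma> \<noteq> 0" by (rule prim_root_nonzero[OF \<gamma> n])
  have a0: "a \<noteq> 0" using prim_root_nonzero[OF \<open>prim_root n \<alpha>\<close> n] by (simp add: a_def)
  have x_root: "?x j ^ n = 1" for j
  proof -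
    have "?x j ^ n = (\<alpha> ^ n) ^ t * (\<gamma> ^ n) ^ j"
      by (simp add: a_def power_mult_distrib mult.commute flip: power_mult)
    then show ?thesis using \<gamma> \<open>prim_root n \<alpha>\<close> by (simp add: prim_root_def)
  qed
  have x_inj: "inj_on ?x {..<n}"
    using inj_on_prim_root_power[OF \<gamma> n] a0 by (simp add: inj_on_def)
  have pow: "\<alpha> ^ (t + j * b) = ?x j" "\<alpha> ^ (j * b) = \<gamma> ^ j" for j
    by (simp_all add: a_def \<gamma>_def power_add mult.commute flip: power_mult)
  have B_eq: "B = {\<gamma> ^ j | j. j \<le> \<delta> - 2}" by (simp add: B_def pow)
  have A_eq: "A = ?x ` exps_A m \<delta>"
    unfolding A_def pow exps_A_def by blast
  have AB_eq: "set_mult A B = ?x ` exps_AB m \<delta>"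
    unfolding exps_AB_eq_sums[OF \<open>m \<ge> 1\<close> \<open>\<delta> \<ge> 2\<close>] A_eq B_eq set_mult_def
  proof (intro equalityI subsetI)
    fix z assume "z \<in> {x * y |x y. x \<in> ?x ` exps_A m \<delta> \<and> y \<in> {\<gamma> ^ j |j. j \<le> \<delta> - 2}}"
    then obtain i j where "z = ?x i * \<gamma> ^ j" "i \<in> exps_A m \<delta>" "j \<le> \<delta> - 2" by blast
    moreover from this have "z = ?x (i + j)" by (simp add: power_add mult.assoc)
    ultimately show "z \<in> ?x ` {i + j |i j. i \<in> exps_A m \<delta> \<and> j \<le> \<delta> - 2}" by blast
  next
    fix z assume "z \<in> ?x ` {i + j |i j. i \<in> exps_A m \<delta> \<and> j \<le> \<delta> - 2}"
    then obtain i j where "z = ?x (i + j)" "i \<in> exps_A m \<delta>" "j \<le> \<delta> - 2" by blast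
    moreover from this have "z = ?x i * \<gamma> ^ j" by (simp add: power_add mult.assoc)
    ultimately show "z \<in> {x * y |x y. x \<in> ?x ` exps_A m \<delta> \<and> y \<in> {\<gamma> ^ j |j. j \<le> \<delta> - 2}}" by blast
  qed
  have A: "finite A" "A \<subseteq> {\<beta>. \<beta> ^ n = 1}" using x_root by (auto simp: A_eq)
  have AB: "finite (set_mult A B)" "set_mult A B \<subseteq> {\<beta>. \<beta> ^ n = 1}" using x_root by (auto simp: AB_eq)

  have "A \<noteq> {}" by (auto simp: A_def)
  then obtain v0 where "v0 \<in> dual_code n (cyclic_code n A)" "v0 \<noteq> 0"
    using dual_cyclic_code_nonzero[OF n A] by blast
  then obtain v where v: "v \<in> dual_code n (cyclic_code n A)" "v \<noteq> 0"
    "min_dist n (dual_code n (cyclic_code n A)) = enat (hweight n v)"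
    by (rule min_dist_attained)
  have r: "r = hweight n v - \<delta> + 1" by (simp add: r_def v(3))
  \<comment> \<open>These \<open>\<delta> - 1\<close> exponents fill the gap of
    \<open>exps_A\<close> between the isolated ones for \<open>e = 0\<close> and
    \<open>e = 1\<close>. All exponents compared are below \<open>n\<close>, where \<open>?x\<close>
    is injective.\<close>
  have notin: "?x (m * \<delta> + 2 + p) \<notin> A" if "p + 1 < \<delta>" for p
  proof
    assume "?x (m * \<delta> + 2 + p) \<in> A"
    then obtain j where j: "j \<in> exps_A m \<delta>" "?x (m * \<delta> + 2 + p) = ?x j" by (auto simp: A_eq)
    have less: "m * \<delta> + 2 + p < (m + 1) * \<delta> + 1" using that by simp
    moreover have "(m + 1) * \<delta> + \<delta> \<le> (2 * m + 1) * \<delta>" using \<open>m \<ge> 1\<close>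
      by (cases m) (auto simp: algebra_simps)
    ultimately have "m * \<delta> + 2 + p < n" using assms(7) \<open>\<delta> \<ge> 2\<close> by linarith
    moreover have "j < n" using j exps_A_subset[OF \<open>\<delta> \<ge> 2\<close>, of m] assms(7) by auto
    ultimately have eq: "j = m * \<delta> + 2 + p" using inj_onD[OF x_inj j(2)] by simp
    from j(1) consider "j \<le> (m - 1) * \<delta> + 1" | e where "j = (m + e) * \<delta> + 1"
      by (auto simp: exps_A_def)
    then show False
    proof cases
      case 1
      moreover have "(m - 1) * \<delta> \<le> m * \<delta>" by (intro mult_right_mono) auto
      ultimately show False using eq by linarith
    next
      case 2
      show False
      proof (cases e)
        case 0
        then show False using 2 eq by simp
      next
        case (Suc e')
        have "(m + 1) * \<delta> \<le> (m + e) * \<delta>" unfolding Suc by (intro mult_right_mono) auto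
        then show False using 2 eq less by linarith
      qed
    qed
  qed
  have wt: "\<delta> \<le> hweight n v"
  proof -
    obtain j where j: "v j \<noteq> 0" using v(2) by (auto simp: fun_eq_iff)
    then have jn: "j < n" using v(1) by (auto simp: dual_code_def vecs_def not_less[symmetric])
    \<comment> \<open>Roots outside \<open>A\<close> yield their inverses as zeros of
      \<open>v\<close>, so the BCH bound is applied along powers of
      \<open>inverse \<gamma>\<close>.\<close>
    show ?thesis
    proof (rule bch_bound[where a = "inverse (?x (m * \<delta> + 2))" and v = v, OF prim_root_inverse[OF \<gamma>] n _ jn j])
      fix p assume "p + 1 < \<delta>"
      have "inverse (?x (m * \<delta> + 2 + p)) = inverse (?x (m * \<delta> + 2)) * inverse \<gamma> ^ p"
        by (simp add: power_add power_inverse mult_ac)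
      then show "(\<Sum>i<n. v i * (inverse (?x (m * \<delta> + 2)) * inverse \<gamma> ^ p) ^ i) = 0"
        using dual_cyclic_code_zeros[OF n A v(1) x_root notin[OF \<open>p + 1 < \<delta>\<close>]] by (simp only:)
    qed (use a0 \<gamma>0 in simp)
  qed
  have lrc: "is_LRC n ?C r \<delta>"
    unfolding r B_eq by (rule cyclic_code_set_mult_is_LRC[OF n A \<gamma> \<open>\<delta> \<ge> 2\<close> v(1,2) wt])

  have "exps_AB m \<delta> \<subseteq> {..<n}" using assms(7) by (auto simp: exps_AB_def)
  then have "card (set_mult A B) = m * \<delta> + (m + 1) * (\<delta> - 1)"
    unfolding AB_eq using inj_on_subset[OF x_inj] card_exps_AB[OF \<open>\<delta> \<ge> 2\<close>, of m]
    by (simp add: card_image)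
  then have dim: "code_dim ?C = k" using code_dim_cyclic_code[OF n AB] by (simp add: k_def)

  have "enat ((m + 1) * \<delta>) \<le> min_dist n ?C"
    unfolding le_min_dist_iff
  proof (intro ballI impI)
    fix c assume c: "c \<in> ?C" "c \<noteq> 0"
    then obtain j where j: "c j \<noteq> 0" by (auto simp: fun_eq_iff)
    then have jn: "j < n" using c(1) by (auto simp: cyclic_code_def vecs_def not_less[symmetric])
    let ?S = "{i. i < n \<and> c i \<noteq> 0}"
    show "(m + 1) * \<delta> \<le> hweight n c"
      unfolding hweight_def
    proof (rule betti_sala_bound[where x = "\<lambda>i. \<gamma> ^ i" and c = "\<lambda>i. c i * a ^ i"])
      show "?S \<noteq> {}" using j jn by auto
      show "inj_on (\<lambda>i. \<gamma> ^ i) ?S"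
        using inj_on_prim_root_power[OF \<gamma> n] by (rule inj_on_subset) auto
      fix p assume "p < (2 * m + 1) * \<delta>" "\<not> (\<delta> dvd p \<and> m * \<delta> \<le> p)"
      then have "p \<in> exps_AB m \<delta>" by (simp add: exps_AB_def)
      then have "?x p \<in> set_mult A B" unfolding AB_eq by (rule imageI)
      then have "(\<Sum>i<n. c i * ?x p ^ i) = 0" using c(1) by (simp add: cyclic_code_iff[OF n AB])
      then show "(\<Sum>i\<in>?S. c i * a ^ i * (\<gamma> ^ i) ^ p) = 0" by (simp only: eval_eq_moment)
    qed (use a0 \<gamma>0 in auto)
  qed
  moreover have "min_dist n ?C \<le> enat ((m + 1) * \<delta>) \<and>
      int ((m + 1) * \<delta>) = int n - int k - int m * (int \<delta> - 1) + 1"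
    if ceil: "\<lceil>real k / real r\<rceil> = int (m + 1)"
  proof -
    have "r \<ge> 1" using lrc by (simp add: is_LRC_def)
    \<comment> \<open>This makes \<open>l = m\<close> admissible in the Singleton bound. The
      resulting \<open>m * r < k\<close> also forces \<open>k > 0\<close>, so the subtractions in
      \<open>k_def\<close> do not truncate.\<close>
    have "real m < real k / real r" using ceil by (simp add: ceiling_eq_iff)
    then have "real (m * r) < real k" using \<open>r \<ge> 1\<close> by (simp add: field_simps)
    then have mr: "m * r < k" by (simp only: of_nat_less_iff)
    have "n = k + m * \<delta> + (m + 1) * (\<delta> - 1)" using mr by (simp add: k_def)
    moreover have "(m + 1) * (\<delta> - 1) = m * (\<delta> - 1) + (\<delta> - 1)" by simp
    moreover have "(m + 1) * \<delta> = m * \<delta> + \<delta>" by simp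
    \<comment> \<open>The second summand is the one in the Singleton bound, so cancelling it leaves
      the claimed distance.\<close>
    ultimately have neq: "n = (m + 1) * \<delta> + (k - 1 + m * (\<delta> - 1))"
      using mr \<open>\<delta> \<ge> 2\<close> by linarith
    have "min_dist n ?C + enat (k - 1 + m * (\<delta> - 1)) \<le> enat n"
      using LRC_singleton_bound[OF subspace_cyclic_code[OF n AB] cyclic_code_subset_vecs lrc, of m] mr
      by (simp add: dim)
    then have "min_dist n ?C \<le> enat ((m + 1) * \<delta>)"
      by (subst (asm) neq, cases "min_dist n ?C") auto
    moreover have "int m * (int \<delta> - 1) = int (m * (\<delta> - 1))" using \<open>\<delta> \<ge> 2\<close> by (simp add: of_nat_diff)
    then have "int ((m + 1) * \<delta>) = int n - int k - int m * (int \<delta> - 1) + 1"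
      using neq mr by linarith
    ultimately show ?thesis by blast
  qed
  ultimately show ?thesis
    using lrc dim by (auto simp: is_optimal_LRC_def intro: antisym)
qed

end
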